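(* Let $\rho$ be a permutation of the set $C=\{1,2,\ldots,N\}$. (1) The set $\mathbb{V}_\rho:=\{v\in\mathbb{R}^N\mid v^\rho=v\}$ of all vectors for which $\rho$ is a state symmetry is a vector space (a linear subspace of $\mathbb{R}^N$). (2) The set $\mathbb{M}_\rho:=\{M\in\mathbb{M}(N\times N,\mathbb{R})\mid M^\rho=M\}$ of all real square matrices for which $\rho$ is a state symmetry is a vector space (a linear subspace of $\mathbb{M}(N\times N,\mathbb{R})$).
   Context: $\mathbb{M}(N\times N,\mathbb{R})$ is the vector space of real $N\times N$ matrices. For a permutation $\rho$ of $C=\{1,\ldots,N\}$, a column vector $v=(v_i)\in\mathbb{R}^N$ and a real $N\times N$ matrix $M=(m_{ij})$, the reordered vector is $v^\rho:=(v_{\rho(i)})_i$ and the reordered matrix is $M^\rho:=(m_{\rho(i)\,\rho(j)})_{i,j}$. The permutation $\rho$ is a state symmetry of $v$ (resp. $M$) if $v^\rho=v$ (resp. $M^\rho=M$). *)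

theory Defs
  imports "HOL-Analysis.Analysis"
begin

text \<open>
  The index set \<open>C = {1, \<dots>, N}\<close> is modelled by an arbitrary finite type \<open>'n\<close> with
  \<open>N = CARD('n)\<close>; a permutation \<open>\<rho>\<close> of \<open>C\<close> is a function with
  \<open>\<rho> permutes UNIV\<close>, which the definitions below presuppose.
\<close>

definition reorder_vec :: "('n \<Rightarrow> 'n) \<Rightarrow> real ^ 'n \<Rightarrow> real ^ 'n"
  where "reorder_vec \<rho> v = (\<chi> i. v $ \<rho> i)"

definition reorder_mat :: "('n \<Rightarrow> 'n) \<Rightarrow> real ^ 'n ^ 'n \<Rightarrow> real ^ 'n ^ 'n"
  where "reorder_mat \<rho> M = (\<chi> i j. M $ \<rho> i $ \<rho> j)"

definition vec_state_symmetry :: "('n \<Rightarrow> 'n) \<Rightarrow> real ^ 'n \<Rightarrow> bool"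
  where "vec_state_symmetry \<rho> v \<longleftrightarrow> reorder_vec \<rho> v = v"

definition mat_state_symmetry :: "('n \<Rightarrow> 'n) \<Rightarrow> real ^ 'n ^ 'n \<Rightarrow> bool"
  where "mat_state_symmetry \<rho> M \<longleftrightarrow> reorder_mat \<rho> M = M"

definition symmetric_vecs :: "('n \<Rightarrow> 'n) \<Rightarrow> (real ^ 'n) set"
  where "symmetric_vecs \<rho> = {v. vec_state_symmetry \<rho> v}"

definition symmetric_mats :: "('n \<Rightarrow> 'n) \<Rightarrow> (real ^ 'n ^ 'n) set"
  where "symmetric_mats \<rho> = {M. mat_state_symmetry \<rho> M}"

end

theory Submission
  imports Defs
begin

text \<open>
  Reordering the entries of a vector or of a matrix is a linear map, because addition and
  scaling act entry by entry and so do not depend on where an entry is placed. The objects for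
  which \<open>\<rho>\<close> is a state symmetry are exactly the fixed points of this map, that is, its
  eigenspace for the eigenvalue 1.
\<close>

lemma subspace_fixed_points:
  fixes f :: "'a::real_vector \<Rightarrow> 'a"
  assumes "linear f"
  shows "subspace {x. f x = x}"
  by (simp add: subspace_def linear_0[OF assms] linear_add[OF assms] linear_scale[OF assms])

lemma linear_reorder_vec: "linear (reorder_vec \<rho>)"
  by (rule linearI) (simp_all add: reorder_vec_def vec_eq_iff)

lemma linear_reorder_mat: "linear (reorder_mat \<rho>)"
  by (rule linearI) (simp_all add: reorder_mat_def vec_eq_iff)

theorem theorem2:
  fixes \<rho> :: "'n::finite \<Rightarrow> 'n"
  assumes "\<rho> permutes UNIV"
  shows "subspace (symmetric_vecs \<rho>) \<and> subspace (symmetric_mats \<rho>)"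
  unfolding symmetric_vecs_def symmetric_mats_def vec_state_symmetry_def mat_state_symmetry_def
  by (intro conjI subspace_fixed_points linear_reorder_vec linear_reorder_mat)

end
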